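(* Let $n\ge 1$ and $\omega>0$. For $i=1,\dots,n$ let $a_i,b_i\in C(\mathbb{R},[0,\infty))$ be $\omega$-periodic with $\bar a_i>0$ and $\bar b_i>0$, let $\tau\in C(\mathbb{R},\mathbb{R})$ be $\omega$-periodic, and let $f^i:\mathbb{R}_+^n\to[0,\infty)$ be continuous with $f^i(\mathbf{x})>0$ whenever $\|\mathbf{x}\|>0$. For $\lambda>0$ consider the system $$x_i'(t)=-a_i(t)x_i(t)+\lambda b_i(t) f^i(\mathbf{x}(t-\tau(t))),\qquad i=1,\dots,n. \quad ( * )$$ Then: (a) If there is a $c_1>0$ such that $f^i(\mathbf{x})\ge c_1\|\mathbf{x}\|$ for all $\mathbf{x}\in\mathbb{R}_+^n$ and $i=1,\dots,n$, then $( * )$ has no positive $\omega$-periodic solution for any $\lambda>\frac{1}{\sigma\Gamma c_1}$. (b) If there is a $c_2>0$ such that $f^i(\mathbf{x})\le c_2\|\mathbf{x}\|$ for all $\mathbf{x}\in\mathbb{R}_+^n$ and $i=1,\dots,n$, then $( * )$ has no positive $\omega$-periodic solution for any $0<\lambda<\frac{1}{c_2\chi}$.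
   Context: Notation: $\mathbb{R}_+=[0,\infty)$, $\mathbb{R}_+^n$ is the nonnegative orthant, $\|\mathbf{x}\|=\sum_{i=1}^n|x_i|$ for $\mathbf{x}\in\mathbb{R}_+^n$, and $\bar g=\frac1\omega\int_0^\omega g(s)\,ds$ for an $\omega$-periodic function $g$. Constants: $\sigma_i=e^{-\bar a_i\omega}$, $\sigma=\min_{1\le i\le n}\sigma_i$, $$\Gamma=\min_{1\le i\le n}\frac{\bar b_i\omega}{\sigma_i^{-1}-1},\qquad \chi=\sum_{i=1}^n\frac{\sigma_i^{-1}}{\sigma_i^{-1}-1}\,\bar b_i\omega.$$ A solution $\mathbf{x}(t)=(x_1(t),\dots,x_n(t))$, $t\in\mathbb{R}$, is called positive if $x_i(t)\ge0$ for all $t\in\mathbb{R}$ and all $i$, and there is at least one component which is positive on all of $\mathbb{R}$. *)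

theory Defs
  imports "HOL-Analysis.Analysis" "HOL-Library.Periodic_Fun"
begin

definition nonneg_orthant :: "(real ^ 'n) set" where
  "nonneg_orthant = {x. \<forall>i. 0 \<le> x $ i}"

(* The library norm on real ^ 'n is the Euclidean one; here the sum norm is meant. *)
definition l1_norm :: "real ^ 'n \<Rightarrow> real" where
  "l1_norm x = (\<Sum>i\<in>UNIV. \<bar>x $ i\<bar>)"

definition period_mean :: "real \<Rightarrow> (real \<Rightarrow> real) \<Rightarrow> real" where
  "period_mean \<omega> g = 1 / \<omega> * integral {0..\<omega>} g"

definition sigma_comp :: "real \<Rightarrow> ('n \<Rightarrow> real \<Rightarrow> real) \<Rightarrow> 'n \<Rightarrow> real" where
  "sigma_comp \<omega> a i = exp (- period_mean \<omega> (a i) * \<omega>)"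

definition sigma_min :: "real \<Rightarrow> ('n::finite \<Rightarrow> real \<Rightarrow> real) \<Rightarrow> real" where
  "sigma_min \<omega> a = (MIN i. sigma_comp \<omega> a i)"

definition Gamma_const ::
  "real \<Rightarrow> ('n::finite \<Rightarrow> real \<Rightarrow> real) \<Rightarrow> ('n \<Rightarrow> real \<Rightarrow> real) \<Rightarrow> real" where
  "Gamma_const \<omega> a b =
     (MIN i. period_mean \<omega> (b i) * \<omega> / (inverse (sigma_comp \<omega> a i) - 1))"

definition chi_const ::
  "real \<Rightarrow> ('n::finite \<Rightarrow> real \<Rightarrow> real) \<Rightarrow> ('n \<Rightarrow> real \<Rightarrow> real) \<Rightarrow> real" where
  "chi_const \<omega> a b =
     (\<Sum>i\<in>UNIV. inverse (sigma_comp \<omega> a i) / (inverse (sigma_comp \<omega> a i) - 1)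
        * (period_mean \<omega> (b i) * \<omega>))"

(* Each f i is only meaningful on the nonnegative orthant, so a solution is required to
   take its values there. *)
definition is_solution ::
  "('n \<Rightarrow> real \<Rightarrow> real) \<Rightarrow> ('n \<Rightarrow> real \<Rightarrow> real) \<Rightarrow> ('n \<Rightarrow> real ^ 'n \<Rightarrow> real) \<Rightarrow> (real \<Rightarrow> real)
     \<Rightarrow> real \<Rightarrow> (real \<Rightarrow> real ^ 'n) \<Rightarrow> bool" where
  "is_solution a b f \<tau> lam x \<longleftrightarrow>
     (\<forall>t. x t \<in> nonneg_orthant) \<and>
     (\<forall>i t. ((\<lambda>s. x s $ i) has_real_derivative
               - a i t * x t $ i + lam * b i t * f i (x (t - \<tau> t))) (at t))"

(* The component that stays positive is the same for all t. *)
definition positive_fun :: "(real \<Rightarrow> real ^ 'n) \<Rightarrow> bool" where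
  "positive_fun x \<longleftrightarrow> (\<forall>t i. 0 \<le> x t $ i) \<and> (\<exists>i. \<forall>t. 0 < x t $ i)"

definition positive_periodic_solution ::
  "real \<Rightarrow> ('n \<Rightarrow> real \<Rightarrow> real) \<Rightarrow> ('n \<Rightarrow> real \<Rightarrow> real) \<Rightarrow> ('n \<Rightarrow> real ^ 'n \<Rightarrow> real) \<Rightarrow> (real \<Rightarrow> real)
     \<Rightarrow> real \<Rightarrow> (real \<Rightarrow> real ^ 'n) \<Rightarrow> bool" where
  "positive_periodic_solution \<omega> a b f \<tau> lam x \<longleftrightarrow>
     is_solution a b f \<tau> lam x \<and> positive_fun x \<and> periodic_fun_simple x \<omega>"

end

theory Submission
  imports Defs
begin

text \<open>
  The equation of one component is linear, \<open>y' = - a y + g\<close>, with the forcing term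
  \<open>g t = lam * b t * f (x (t - \<tau> t)) \<ge> 0\<close>. Let \<open>A\<close> be an antiderivative of \<open>a\<close>; then
  \<open>A (t + \<omega>) = A t + \<alpha>\<close> with \<open>exp (- \<alpha>) = \<sigma>\<^sub>i\<close>, and \<open>(y * exp A)' = exp A * g\<close>. For a
  nonnegative \<open>\<omega>\<close>-periodic \<open>y\<close> this has two consequences.

  \<^item> As \<open>y * exp A\<close> increases, \<open>y\<close> cannot drop by more than the factor \<open>\<sigma>\<^sub>i\<close> within one period,
    so any two values of \<open>y\<close> are comparable up to that factor
    (\<open>periodic_values_comparable\<close>).
  \<^item> The increment of \<open>y * exp A\<close> over \<open>[t, t + \<omega>]\<close> is \<open>(1 / \<sigma>\<^sub>i - 1) * y t * exp (A t)\<close>, and on that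
    interval \<open>exp (A t) \<le> exp A \<le> exp (A t) / \<sigma>\<^sub>i\<close>. Hence a bound \<open>g \<ge> K * b\<close> or \<open>g \<le> K * b\<close> becomes
    a lower or an upper bound for \<open>y t\<close> in terms of \<open>K\<close> and the integral of \<open>b\<close> over a period
    (\<open>periodic_forced_lower_bound\<close>, \<open>periodic_forced_upper_bound\<close>).

  In part (a) the comparison of values makes \<open>f\<^sup>i (x (s - \<tau> s)) \<ge> c\<^sub>1 \<sigma> \<parallel>x t\<parallel>\<close> for all \<open>s\<close>, so the lower
  bound reads \<open>x\<^sub>i t \<ge> lam c\<^sub>1 \<sigma> \<Gamma> \<parallel>x t\<parallel>\<close>. For large \<open>lam\<close> the right-hand side exceeds \<open>\<parallel>x t\<parallel>\<close>, and no
  component can exceed the norm. In part (b), with \<open>M\<close> the supremum of \<open>\<parallel>x\<parallel>\<close>, adding the upper bounds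
  of all components gives \<open>\<parallel>x t\<parallel> \<le> lam c\<^sub>2 \<chi> M\<close> for all \<open>t\<close>, so \<open>M \<le> lam c\<^sub>2 \<chi> M\<close>; for small \<open>lam\<close> the factor
  is below \<open>1\<close>, which forces \<open>M \<le> 0\<close>.
\<close>

lemma periodic_antiderivative:
  fixes g :: "real \<Rightarrow> real"
  assumes "\<omega> > 0" and cont: "continuous_on UNIV g" and per: "periodic_fun_simple g \<omega>"
  obtains G where "\<And>t. (G has_real_derivative g t) (at t)"
    and "\<And>t. G (t + \<omega>) = G t + period_mean \<omega> g * \<omega>"
proof -
  have "\<exists>G. \<forall>t::real. - \<infinity> < ereal t \<longrightarrow> ereal t < \<infinity> \<longrightarrow> (G has_vector_derivative g t) (at t)"
    by (rule einterval_antiderivative) (use cont in \<open>auto simp: continuous_on_eq_continuous_at\<close>)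
  then obtain G where G: "(G has_real_derivative g t) (at t)" for t
    by (auto simp: has_real_derivative_iff_has_vector_derivative)
  have "((\<lambda>t. G (t + \<omega>) - G t) has_real_derivative 0) (at t)" for t
    using DERIV_diff[OF DERIV_shift[THEN iffD1, OF G[of "t + \<omega>"]] G[of t]]
      periodic_fun_simple.plus_period[OF per, of t] by simp
  then have const: "G (t + \<omega>) - G t = G (0 + \<omega>) - G 0" for t
    using DERIV_isconst_all[of "\<lambda>t. G (t + \<omega>) - G t" t 0] by blast
  have "(g has_integral (G \<omega> - G 0)) {0..\<omega>}"
    by (rule fundamental_theorem_of_calculus)
      (use \<open>\<omega> > 0\<close> G in \<open>auto simp flip: has_real_derivative_iff_has_vector_derivative
         intro: has_field_derivative_at_within\<close>)
  then have "period_mean \<omega> g * \<omega> = G \<omega> - G 0"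
    using \<open>\<omega> > 0\<close> by (simp add: period_mean_def integral_unique)
  then have "G (t + \<omega>) = G t + period_mean \<omega> g * \<omega>" for t
    using const[of t] by simp
  with G that show thesis by blast
qed

lemma integrating_factor:
  fixes y A :: "real \<Rightarrow> real"
  assumes "(y has_real_derivative - a * y t + g) (at t)" and "(A has_real_derivative a) (at t)"
  shows "((\<lambda>t. y t * exp (A t)) has_real_derivative exp (A t) * g) (at t)"
  using assms by (auto intro!: derivative_eq_intros simp: algebra_simps)

lemma mono_if_derivative_nonneg:
  fixes F F' :: "real \<Rightarrow> real"
  assumes "\<And>t. (F has_real_derivative F' t) (at t)" and "\<And>t. 0 \<le> F' t" and "s \<le> t"
  shows "F s \<le> F t"
  using DERIV_nonneg_imp_nondecreasing[of s t F] assms by blast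

lemma increment_le_if_derivative_le:
  fixes F G F' G' :: "real \<Rightarrow> real"
  assumes "\<And>r. (F has_real_derivative F' r) (at r)" and "\<And>r. (G has_real_derivative G' r) (at r)"
    and "\<And>r. s \<le> r \<Longrightarrow> r \<le> t \<Longrightarrow> F' r \<le> G' r" and "s \<le> t"
  shows "F t - F s \<le> G t - G s"
proof -
  have "G s - F s \<le> G t - F t"
    by (rule DERIV_nonneg_imp_nondecreasing[OF \<open>s \<le> t\<close>])
      (use DERIV_diff[OF assms(2,1)] assms(3) in \<open>force simp: le_diff_eq\<close>)
  then show ?thesis by simp
qed

text \<open>
  By periodicity the two points may be taken less than one period apart, in the order in which the
  monotonicity of \<open>y * exp A\<close> applies; over that distance \<open>exp A\<close> grows at most by the factor
  \<open>exp (period_mean \<omega> a * \<omega>)\<close>.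
\<close>

lemma periodic_values_comparable:
  fixes y a g :: "real \<Rightarrow> real"
  assumes "\<omega> > 0"
    and a: "continuous_on UNIV a" "\<And>t. 0 \<le> a t" "periodic_fun_simple a \<omega>"
    and y: "\<And>t. 0 \<le> y t" "periodic_fun_simple y \<omega>"
    and deriv: "\<And>t. (y has_real_derivative - a t * y t + g t) (at t)"
    and g: "\<And>t. 0 \<le> g t"
  shows "exp (- period_mean \<omega> a * \<omega>) * y s \<le> y t"
proof -
  obtain A where A: "\<And>t. (A has_real_derivative a t) (at t)"
    and shift: "\<And>t. A (t + \<omega>) = A t + period_mean \<omega> a * \<omega>"
    using periodic_antiderivative[OF \<open>\<omega> > 0\<close> a(1,3)] by metis
  define n where "n = \<lfloor>(t - s) / \<omega>\<rfloor>"
  define r where "r = s + of_int n * \<omega>"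
  have "of_int n \<le> (t - s) / \<omega>" "(t - s) / \<omega> \<le> of_int n + 1"
    unfolding n_def by linarith+
  then have r: "r \<le> t" "t \<le> r + \<omega>"
    using \<open>\<omega> > 0\<close> by (simp_all add: r_def field_simps)
  interpret y: periodic_fun_simple y \<omega> by (rule y)
  have "y s = y r"
    by (simp add: r_def y.plus_of_int)
  have "y r * exp (A r) \<le> y t * exp (A t)"
    by (rule mono_if_derivative_nonneg[OF integrating_factor[OF deriv A]]) (use g r in auto)
  also have "A t \<le> A r + period_mean \<omega> a * \<omega>"
    using mono_if_derivative_nonneg[OF A a(2) r(2)] by (simp add: shift)
  then have "y t * exp (A t) \<le> y t * (exp (period_mean \<omega> a * \<omega>) * exp (A r))"
    using y(1) by (intro mult_left_mono) (simp_all add: exp_add[symmetric] add.commute)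
  finally have "y r \<le> y t * exp (period_mean \<omega> a * \<omega>)"
    by (simp flip: mult.assoc)
  then show ?thesis
    by (simp add: \<open>y s = y r\<close> exp_minus field_simps)
qed

text \<open>
  Both bounds compare the increments of \<open>y * exp A\<close> and of a multiple of an antiderivative of \<open>b\<close>
  through their derivatives, in place of integrating \<open>exp A * g\<close> over a period.
\<close>

lemma periodic_forced_lower_bound:
  fixes y a b g :: "real \<Rightarrow> real"
  assumes "\<omega> > 0"
    and a: "continuous_on UNIV a" "\<And>t. 0 \<le> a t" "periodic_fun_simple a \<omega>"
    and b: "continuous_on UNIV b" "\<And>t. 0 \<le> b t" "periodic_fun_simple b \<omega>"
    and y: "periodic_fun_simple y \<omega>"
    and deriv: "\<And>t. (y has_real_derivative - a t * y t + g t) (at t)"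
    and K: "0 \<le> K" and g: "\<And>t. K * b t \<le> g t"
  shows "K * (period_mean \<omega> b * \<omega>) \<le> (exp (period_mean \<omega> a * \<omega>) - 1) * y t"
proof -
  obtain A where A: "\<And>t. (A has_real_derivative a t) (at t)"
    and A_shift: "\<And>t. A (t + \<omega>) = A t + period_mean \<omega> a * \<omega>"
    using periodic_antiderivative[OF \<open>\<omega> > 0\<close> a(1,3)] by metis
  obtain B where B: "\<And>t. (B has_real_derivative b t) (at t)"
    and B_shift: "\<And>t. B (t + \<omega>) = B t + period_mean \<omega> b * \<omega>"
    using periodic_antiderivative[OF \<open>\<omega> > 0\<close> b(1,3)] by metis
  have "exp (A t) * K * B (t + \<omega>) - exp (A t) * K * B t
      \<le> y (t + \<omega>) * exp (A (t + \<omega>)) - y t * exp (A t)"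
  proof (rule increment_le_if_derivative_le[OF DERIV_cmult[OF B] integrating_factor[OF deriv A]])
    fix r assume "t \<le> r"
    then have "A t \<le> A r"
      by (rule mono_if_derivative_nonneg[OF A a(2)])
    then have "exp (A t) * (K * b r) \<le> exp (A r) * g r"
      using K b(2) g by (intro mult_mono) auto
    then show "exp (A t) * K * b r \<le> exp (A r) * g r"
      by (simp add: mult.assoc)
  qed (use \<open>\<omega> > 0\<close> in simp)
  then have "exp (A t) * (K * (period_mean \<omega> b * \<omega>))
      \<le> exp (A t) * ((exp (period_mean \<omega> a * \<omega>) - 1) * y t)"
    unfolding A_shift B_shift periodic_fun_simple.plus_period[OF y] exp_add
    by (simp add: algebra_simps)
  then show ?thesis by simp
qed

lemma periodic_forced_upper_bound:
  fixes y a b g :: "real \<Rightarrow> real"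
  assumes "\<omega> > 0"
    and a: "continuous_on UNIV a" "\<And>t. 0 \<le> a t" "periodic_fun_simple a \<omega>"
    and b: "continuous_on UNIV b" "\<And>t. 0 \<le> b t" "periodic_fun_simple b \<omega>"
    and y: "periodic_fun_simple y \<omega>"
    and deriv: "\<And>t. (y has_real_derivative - a t * y t + g t) (at t)"
    and K: "0 \<le> K" and g: "\<And>t. g t \<le> K * b t"
  shows "(exp (period_mean \<omega> a * \<omega>) - 1) * y t
    \<le> exp (period_mean \<omega> a * \<omega>) * (K * (period_mean \<omega> b * \<omega>))"
proof -
  obtain A where A: "\<And>t. (A has_real_derivative a t) (at t)"
    and A_shift: "\<And>t. A (t + \<omega>) = A t + period_mean \<omega> a * \<omega>"
    using periodic_antiderivative[OF \<open>\<omega> > 0\<close> a(1,3)] by metis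
  obtain B where B: "\<And>t. (B has_real_derivative b t) (at t)"
    and B_shift: "\<And>t. B (t + \<omega>) = B t + period_mean \<omega> b * \<omega>"
    using periodic_antiderivative[OF \<open>\<omega> > 0\<close> b(1,3)] by metis
  have "y (t + \<omega>) * exp (A (t + \<omega>)) - y t * exp (A t)
      \<le> exp (A (t + \<omega>)) * K * B (t + \<omega>) - exp (A (t + \<omega>)) * K * B t"
  proof (rule increment_le_if_derivative_le[OF integrating_factor[OF deriv A] DERIV_cmult[OF B]])
    fix r assume "r \<le> t + \<omega>"
    then have "A r \<le> A (t + \<omega>)"
      by (rule mono_if_derivative_nonneg[OF A a(2)])
    then have "exp (A r) * (K * b r) \<le> exp (A (t + \<omega>)) * (K * b r)"
      using K b(2) by (intro mult_right_mono) auto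
    moreover have "exp (A r) * g r \<le> exp (A r) * (K * b r)"
      using g by simp
    ultimately show "exp (A r) * g r \<le> exp (A (t + \<omega>)) * K * b r"
      unfolding mult.assoc by linarith
  qed (use \<open>\<omega> > 0\<close> in simp)
  then have "exp (A t) * ((exp (period_mean \<omega> a * \<omega>) - 1) * y t)
      \<le> exp (A t) * (exp (period_mean \<omega> a * \<omega>) * (K * (period_mean \<omega> b * \<omega>)))"
    unfolding A_shift B_shift periodic_fun_simple.plus_period[OF y] exp_add
    by (simp add: algebra_simps)
  then show ?thesis by simp
qed

theorem theorem2p2:
  fixes \<omega> :: real
    and a b :: "'n::finite \<Rightarrow> real \<Rightarrow> real"
    and \<tau> :: "real \<Rightarrow> real"
    and f :: "'n \<Rightarrow> real ^ 'n \<Rightarrow> real"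
  assumes "\<omega> > 0"
    and "\<And>i. continuous_on UNIV (a i)" and "\<And>i t. 0 \<le> a i t"
    and "\<And>i. periodic_fun_simple (a i) \<omega>" and "\<And>i. period_mean \<omega> (a i) > 0"
    and "\<And>i. continuous_on UNIV (b i)" and "\<And>i t. 0 \<le> b i t"
    and "\<And>i. periodic_fun_simple (b i) \<omega>" and "\<And>i. period_mean \<omega> (b i) > 0"
    and "continuous_on UNIV \<tau>" and "periodic_fun_simple \<tau> \<omega>"
    and "\<And>i. continuous_on nonneg_orthant (f i)"
    and "\<And>i x. x \<in> nonneg_orthant \<Longrightarrow> 0 \<le> f i x"
    and "\<And>i x. x \<in> nonneg_orthant \<Longrightarrow> l1_norm x > 0 \<Longrightarrow> f i x > 0"
  shows
    "(\<forall>c\<^sub>1>0. (\<forall>x\<in>nonneg_orthant. \<forall>i. f i x \<ge> c\<^sub>1 * l1_norm x) \<longrightarrow>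
        (\<forall>lam>0. lam > 1 / (sigma_min \<omega> a * Gamma_const \<omega> a b * c\<^sub>1) \<longrightarrow>
           \<not> (\<exists>x. positive_periodic_solution \<omega> a b f \<tau> lam x)))
     \<and>
     (\<forall>c\<^sub>2>0. (\<forall>x\<in>nonneg_orthant. \<forall>i. f i x \<le> c\<^sub>2 * l1_norm x) \<longrightarrow>
        (\<forall>lam>0. lam < 1 / (c\<^sub>2 * chi_const \<omega> a b) \<longrightarrow>
           \<not> (\<exists>x. positive_periodic_solution \<omega> a b f \<tau> lam x)))"
proof -
  define E where "E i = exp (period_mean \<omega> (a i) * \<omega>)" for i
  define \<beta> where "\<beta> i = period_mean \<omega> (b i) * \<omega>" for i
  have E: "E i > 1" for i
    using assms(1,5) by (simp add: E_def)
  have \<beta>: "\<beta> i > 0" for i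
    using assms(1,9) by (simp add: \<beta>_def)
  have sigma: "sigma_comp \<omega> a i = inverse (E i)" for i
    by (simp add: sigma_comp_def E_def exp_minus)
  have sigma_min_le: "sigma_min \<omega> a \<le> inverse (E i)" for i
    unfolding sigma_min_def sigma by (rule Min_le) auto
  have sigma_min_pos: "0 < sigma_min \<omega> a"
    unfolding sigma_min_def sigma by (subst Min_gr_iff) (auto simp: E_def)
  have Gamma_le: "Gamma_const \<omega> a b \<le> \<beta> i / (E i - 1)" for i
    unfolding Gamma_const_def sigma \<beta>_def inverse_inverse_eq by (rule Min_le) auto
  have Gamma_pos: "0 < Gamma_const \<omega> a b"
    unfolding Gamma_const_def sigma inverse_inverse_eq \<beta>_def[symmetric]
    by (subst Min_gr_iff) (use E \<beta> in auto)
  have chi: "chi_const \<omega> a b = (\<Sum>i\<in>UNIV. E i / (E i - 1) * \<beta> i)"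
    by (simp add: chi_const_def sigma \<beta>_def)
  have chi_pos: "0 < chi_const \<omega> a b"
    unfolding chi by (rule sum_pos) (use E \<beta> in \<open>auto intro!: mult_pos_pos divide_pos_pos
      intro: less_trans[OF zero_less_one]\<close>)

  have solution_props: "x t \<in> nonneg_orthant" "0 \<le> x t $ i" "periodic_fun_simple (\<lambda>s. x s $ i) \<omega>"
      "((\<lambda>s. x s $ i) has_real_derivative
          - a i t * x t $ i + lam * b i t * f i (x (t - \<tau> t))) (at t)"
      "sigma_min \<omega> a * x s $ i \<le> x t $ i"
      "l1_norm (x t) = (\<Sum>i\<in>UNIV. x t $ i)" "0 < l1_norm (x t)"
    if "positive_periodic_solution \<omega> a b f \<tau> lam x" and "lam > 0" for x lam t s i
  proof -
    have orthant: "\<And>t. x t \<in> nonneg_orthant"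
      and nonneg: "\<And>t i. 0 \<le> x t $ i"
      and deriv: "\<And>t i. ((\<lambda>s. x s $ i) has_real_derivative
            - a i t * x t $ i + lam * b i t * f i (x (t - \<tau> t))) (at t)"
      and per: "periodic_fun_simple x \<omega>"
      using that by (auto simp: positive_periodic_solution_def is_solution_def positive_fun_def)
    show per_i: "periodic_fun_simple (\<lambda>s. x s $ i) \<omega>" for i
      using periodic_fun_simple.plus_period[OF per] by unfold_locales simp
    have "exp (- period_mean \<omega> (a i) * \<omega>) * x s $ i \<le> x t $ i"
      by (rule periodic_values_comparable[OF assms(1-4) nonneg per_i deriv])
        (use assms(7,13) orthant \<open>lam > 0\<close> in simp)
    then have "inverse (E i) * x s $ i \<le> x t $ i"
      by (simp add: E_def exp_minus)
    with mult_right_mono[OF sigma_min_le[of i] nonneg[of s i]]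
    show "sigma_min \<omega> a * x s $ i \<le> x t $ i" by linarith
    show norm: "l1_norm (x t) = (\<Sum>i\<in>UNIV. x t $ i)"
      using nonneg by (simp add: l1_norm_def)
    have "\<exists>j. \<forall>t. 0 < x t $ j"
      using that by (simp add: positive_periodic_solution_def positive_fun_def)
    then obtain j where "0 < x t $ j"
      by blast
    then show "0 < l1_norm (x t)"
      unfolding norm using nonneg by (intro sum_pos2[of _ j]) auto
  qed (use that in \<open>auto simp: positive_periodic_solution_def is_solution_def positive_fun_def\<close>)

  have part_a: False
    if "c > 0" and growth: "\<forall>x\<in>nonneg_orthant. \<forall>i. f i x \<ge> c * l1_norm x"
      and "lam > 0" and large: "lam > 1 / (sigma_min \<omega> a * Gamma_const \<omega> a b * c)"
      and sol: "positive_periodic_solution \<omega> a b f \<tau> lam x" for c lam x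
  proof -
    note x = solution_props[OF sol \<open>lam > 0\<close>]
    \<comment> \<open>The contradiction arises at every time and in every component; fix one of each.\<close>
    fix i :: 'n
    define N where "N = l1_norm (x 0)"
    have "N > 0"
      using x(7) by (simp add: N_def)
    have norm_ge: "sigma_min \<omega> a * N \<le> l1_norm (x s)" for s
      unfolding N_def x(6) sum_distrib_left by (rule sum_mono) (rule x(5))
    have "lam * c * (sigma_min \<omega> a * N) * \<beta> i \<le> (E i - 1) * x 0 $ i"
      unfolding \<beta>_def E_def
    proof (rule periodic_forced_lower_bound[OF assms(1-4,6-8) x(3) x(4)])
      fix s
      have "c * (sigma_min \<omega> a * N) \<le> c * l1_norm (x (s - \<tau> s))"
        using norm_ge \<open>c > 0\<close> by simp
      also have "\<dots> \<le> f i (x (s - \<tau> s))"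
        using growth x(1) by blast
      finally have "lam * b i s * (c * (sigma_min \<omega> a * N)) \<le> lam * b i s * f i (x (s - \<tau> s))"
        using \<open>lam > 0\<close> assms(7) by (intro mult_left_mono) auto
      then show "lam * c * (sigma_min \<omega> a * N) * b i s \<le> lam * b i s * f i (x (s - \<tau> s))"
        by (simp add: mult_ac)
    qed (use \<open>lam > 0\<close> \<open>c > 0\<close> \<open>N > 0\<close> sigma_min_pos in simp)
    then have lower: "lam * c * (sigma_min \<omega> a * N) * (\<beta> i / (E i - 1)) \<le> x 0 $ i"
      using E[of i] by (simp add: field_simps)
    have "1 < lam * (sigma_min \<omega> a * Gamma_const \<omega> a b * c)"
      using large sigma_min_pos Gamma_pos \<open>c > 0\<close> by (simp add: pos_divide_less_eq)
    then have "1 * N < lam * (sigma_min \<omega> a * Gamma_const \<omega> a b * c) * N"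
      using \<open>N > 0\<close> by (rule mult_strict_right_mono)
    then have "N < lam * c * (sigma_min \<omega> a * N) * Gamma_const \<omega> a b"
      by (simp add: mult_ac)
    also have "\<dots> \<le> lam * c * (sigma_min \<omega> a * N) * (\<beta> i / (E i - 1))"
      using Gamma_le \<open>lam > 0\<close> \<open>c > 0\<close> \<open>N > 0\<close> sigma_min_pos by (intro mult_left_mono) simp_all
    also note lower
    also have "x 0 $ i \<le> N"
      unfolding N_def x(6) using x(2) by (intro member_le_sum) auto
    finally show False by simp
  qed

  have part_b: False
    if "c > 0" and growth: "\<forall>x\<in>nonneg_orthant. \<forall>i. f i x \<le> c * l1_norm x"
      and "lam > 0" and small: "lam < 1 / (c * chi_const \<omega> a b)"
      and sol: "positive_periodic_solution \<omega> a b f \<tau> lam x" for c lam x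
  proof -
    note x = solution_props[OF sol \<open>lam > 0\<close>]
    define M where "M = (SUP t. l1_norm (x t))"
    \<comment> \<open>Comparability of values bounds the norm, so the supremum is meaningful.\<close>
    have "l1_norm (x t) \<le> l1_norm (x 0) / sigma_min \<omega> a" for t
    proof -
      have "sigma_min \<omega> a * l1_norm (x t) \<le> l1_norm (x 0)"
        unfolding x(6) sum_distrib_left by (rule sum_mono) (rule x(5))
      then show ?thesis
        using sigma_min_pos by (simp add: field_simps)
    qed
    then have "bdd_above (range (\<lambda>t. l1_norm (x t)))"
      by (rule bdd_aboveI2)
    then have M: "l1_norm (x t) \<le> M" for t
      unfolding M_def by (rule cSUP_upper[OF UNIV_I])
    have "M > 0"
      using less_le_trans[OF x(7) M] .
    have upper: "x t $ i \<le> lam * c * M * (E i / (E i - 1) * \<beta> i)" for t i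
    proof -
      have "(E i - 1) * x t $ i \<le> E i * (lam * c * M * \<beta> i)"
        unfolding \<beta>_def E_def
      proof (rule periodic_forced_upper_bound[OF assms(1-4,6-8) x(3) x(4)])
        fix s
        have "f i (x (s - \<tau> s)) \<le> c * l1_norm (x (s - \<tau> s))"
          using growth x(1) by blast
        also have "\<dots> \<le> c * M"
          using M \<open>c > 0\<close> by simp
        finally have "lam * b i s * f i (x (s - \<tau> s)) \<le> lam * b i s * (c * M)"
          using \<open>lam > 0\<close> assms(7) by (intro mult_left_mono) auto
        then show "lam * b i s * f i (x (s - \<tau> s)) \<le> lam * c * M * b i s"
          by (simp add: mult_ac)
      qed (use \<open>lam > 0\<close> \<open>c > 0\<close> \<open>M > 0\<close> in simp)
      then show ?thesis
        using E[of i] by (simp add: field_simps)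
    qed
    have "l1_norm (x t) \<le> lam * c * M * chi_const \<omega> a b" for t
      unfolding x(6) chi sum_distrib_left by (rule sum_mono) (rule upper)
    then have "M \<le> lam * c * M * chi_const \<omega> a b"
      unfolding M_def by (intro cSUP_least) auto
    moreover have "lam * (c * chi_const \<omega> a b) < 1"
      using small \<open>c > 0\<close> chi_pos by (simp add: pos_less_divide_eq)
    then have "lam * (c * chi_const \<omega> a b) * M < 1 * M"
      using \<open>M > 0\<close> by (rule mult_strict_right_mono)
    ultimately show False
      by (simp add: mult_ac)
  qed

  from part_a part_b show ?thesis by blast
qed

end
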